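(* Let $(x_s^m)_{s\ge 0}$ and $(w_s)_{s\ge 0}$ be the iterates of the algorithm Free-SVRG (described in the context) run with inner-loop length $m\ge 1$, step size $\alpha>0$ and a sampling vector $v\sim\mathcal D$. Let $\mathcal L\ge 0$ be an expected smoothness constant and $\rho\ge 0$ an expected residual constant for $v$. Define for $s\ge 0$ $$\phi_s := \|x_s^m-x^*\|_2^2+\psi_s,\qquad \psi_s := 8\alpha^2\rho\, S_m\,(f(w_s)-f(x^* )).$$ If $\alpha\le \frac{1}{2(\mathcal L+2\rho)}$, then for all $s\ge 0$ $$\mathbb E[\phi_s]\le \beta^s\phi_0,\qquad\text{where}\qquad \beta=\max\left\{(1-\alpha\mu)^m,\ \tfrac12\right\}.$$
   Context: Setting: $f(x)=\frac1n\sum_{i=1}^n f_i(x)$ on $\mathbb R^d$, with $x^*$ a minimizer of $f$. There are $L\ge0$, $\mu\ge0$ such that for all $x,y$: $f(x)\le f(y)+\langle\nabla f(y),x-y\rangle+\frac L2\|x-y\|_2^2$ ($L$-smoothness) and $f(x)\le f(y)+\langle\nabla f(x),x-y\rangle-\frac\mu2\|x-y\|_2^2$ ($\mu$-strong convexity). Each $f_i$ is differentiable, convex and $L_i$-smooth for some $L_i\ge 0$. A sampling vector is a random vector $v=(v_1,\dots,v_n)\in\mathbb R^n$ with distribution $\mathcal D$ and $\mathbb E_{\mathcal D}[v_i]=1$ for all $i$. Write $f_v(x)=\frac1n\sum_i v_if_i(x)$ and $\nabla f_v(x)=\frac1n\sum_i v_i\nabla f_i(x)$. Expected smoothness constant: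 $\mathcal L\ge0$ such that $\mathbb E_{\mathcal D}\|\nabla f_v(x)-\nabla f_v(x^* )\|_2^2\le 2\mathcal L(f(x)-f(x^* ))$ for all $x\in\mathbb R^d$. Expected residual constant: $\rho\ge0$ such that $\mathbb E_{\mathcal D}\|\nabla f_v(x)-\nabla f_v(x^* )-\nabla f(x)\|_2^2\le 2\rho(f(x)-f(x^* ))$ for all $x\in\mathbb R^d$. Notation: $S_m=\sum_{i=0}^{m-1}(1-\alpha\mu)^{m-1-i}$ and $p_t=\frac{(1-\alpha\mu)^{m-1-t}}{S_m}$ for $t=0,\dots,m-1$. Free-SVRG: initialize $w_0=x_0^m\in\mathbb R^d$ (deterministic). For $s=1,2,\dots$: set $x_s^0=x_{s-1}^m$; for $t=0,\dots,m-1$, sample $v_t\sim\mathcal D$ (a fresh independent draw at each step), set $g_s^t=\nabla f_{v_t}(x_s^t)-\nabla f_{v_t}(w_{s-1})+\nabla f(w_{s-1})$ and $x_s^{t+1}=x_s^t-\alpha g_s^t$; then set $w_s=\sum_{t=0}^{m-1}p_tx_s^t$. *)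

theory Defs
  imports "HOL-Probability.Probability"
begin

definition grad :: "('a::euclidean_space \<Rightarrow> real) \<Rightarrow> 'a \<Rightarrow> 'a" where
  "grad g x = (THE D. GDERIV g x :> D)"

lemma GDERIV_grad:
  fixes g :: "'a::euclidean_space \<Rightarrow> real"
  assumes "g differentiable (at x)"
  shows "GDERIV g x :> grad g x"
proof -
  obtain g' where g': "(g has_derivative g') (at x)"
    using assms unfolding differentiable_def by blast
  define D where "D = (\<Sum>b\<in>Basis. g' b *\<^sub>R b)"
  interpret bounded_linear g' using g' by (rule has_derivative_bounded_linear)
  have "g' h = inner h D" for h
  proof -
    have "g' h = g' (\<Sum>b\<in>Basis. inner h b *\<^sub>R b)"
      by (simp add: euclidean_representation)
    also have "\<dots> = (\<Sum>b\<in>Basis. inner h b * g' b)"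
      by (simp add: sum scaleR)
    also have "\<dots> = inner h D"
      by (simp add: D_def inner_sum_right mult.commute)
    finally show ?thesis .
  qed
  then have 1: "GDERIV g x :> D"
    using g' unfolding gderiv_def by presburger
  moreover have "D' = D" if "GDERIV g x :> D'" for D'
  proof -
    have "(\<lambda>h. inner h D') = (\<lambda>h. inner h D)"
      using that 1 unfolding gderiv_def by (rule has_derivative_unique)
    then have "inner (D' - D) D' = inner (D' - D) D" by metis
    then have "inner (D' - D) (D' - D) = 0" by (simp add: inner_diff_right)
    then show ?thesis by simp
  qed
  ultimately show ?thesis unfolding grad_def by (rule theI)
qed

definition L_smooth :: "real \<Rightarrow> ('a::euclidean_space \<Rightarrow> real) \<Rightarrow> bool" where
  "L_smooth L g \<longleftrightarrow> L \<ge> 0 \<and>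
     (\<forall>x y. g x \<le> g y + inner (grad g y) (x - y) + L / 2 * (norm (x - y))\<^sup>2)"

definition strongly_convex :: "real \<Rightarrow> ('a::euclidean_space \<Rightarrow> real) \<Rightarrow> bool" where
  "strongly_convex \<mu> g \<longleftrightarrow> \<mu> \<ge> 0 \<and>
     (\<forall>x y. g x \<le> g y + inner (grad g x) (x - y) - \<mu> / 2 * (norm (x - y))\<^sup>2)"

definition avg :: "('n::finite \<Rightarrow> 'a \<Rightarrow> real) \<Rightarrow> 'a \<Rightarrow> real" where
  "avg F x = (1 / real CARD('n)) * (\<Sum>i\<in>UNIV. F i x)"

definition sampled_grad ::
    "('n::finite \<Rightarrow> 'a::euclidean_space \<Rightarrow> real) \<Rightarrow> real ^ 'n \<Rightarrow> 'a \<Rightarrow> 'a" where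
  "sampled_grad F v x = (1 / real CARD('n)) *\<^sub>R (\<Sum>i\<in>UNIV. (v $ i) *\<^sub>R grad (F i) x)"

definition sampling_distribution :: "(real ^ 'n::finite) measure \<Rightarrow> bool" where
  "sampling_distribution D \<longleftrightarrow> prob_space D \<and> sets D = sets borel \<and>
     (\<forall>i. integrable D (\<lambda>v. v $ i) \<and> (LINT v|D. v $ i) = 1)"

text \<open>The Bochner integral of a non-integrable function is 0, so every bound on an expectation
  below also asserts that the expectation is finite.\<close>

definition expected_smoothness ::
    "('n::finite \<Rightarrow> 'a::euclidean_space \<Rightarrow> real) \<Rightarrow> (real ^ 'n) measure \<Rightarrow> 'a \<Rightarrow> real \<Rightarrow> bool" where
  "expected_smoothness F D xstar LL \<longleftrightarrow> LL \<ge> 0 \<and>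
     (\<forall>x. integrable D (\<lambda>v. (norm (sampled_grad F v x - sampled_grad F v xstar))\<^sup>2) \<and>
          (LINT v|D. (norm (sampled_grad F v x - sampled_grad F v xstar))\<^sup>2)
            \<le> 2 * LL * (avg F x - avg F xstar))"

definition expected_residual ::
    "('n::finite \<Rightarrow> 'a::euclidean_space \<Rightarrow> real) \<Rightarrow> (real ^ 'n) measure \<Rightarrow> 'a \<Rightarrow> real \<Rightarrow> bool" where
  "expected_residual F D xstar \<rho> \<longleftrightarrow> \<rho> \<ge> 0 \<and>
     (\<forall>x. integrable D
            (\<lambda>v. (norm (sampled_grad F v x - sampled_grad F v xstar - grad (avg F) x))\<^sup>2) \<and>
          (LINT v|D. (norm (sampled_grad F v x - sampled_grad F v xstar - grad (avg F) x))\<^sup>2)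
            \<le> 2 * \<rho> * (avg F x - avg F xstar))"

definition weight_sum :: "real \<Rightarrow> real \<Rightarrow> nat \<Rightarrow> real" where
  "weight_sum \<alpha> \<mu> m = (\<Sum>i<m. (1 - \<alpha> * \<mu>) ^ (m - 1 - i))"

definition weight :: "real \<Rightarrow> real \<Rightarrow> nat \<Rightarrow> nat \<Rightarrow> real" where
  "weight \<alpha> \<mu> m t = (1 - \<alpha> * \<mu>) ^ (m - 1 - t) / weight_sum \<alpha> \<mu> m"

text \<open>\<open>svrg_inner F \<alpha> w u x t\<close> is the \<open>t\<close>-th inner iterate started at \<open>x\<close>, with reference
  point \<open>w\<close> and sampling vectors \<open>u 0, u 1, \<dots>\<close>.\<close>

primrec svrg_inner ::
    "('n::finite \<Rightarrow> 'a::euclidean_space \<Rightarrow> real) \<Rightarrow> real \<Rightarrow> 'a \<Rightarrow> (nat \<Rightarrow> real ^ 'n) \<Rightarrow> 'a \<Rightarrow> nat \<Rightarrow> 'a"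
  where
    "svrg_inner F \<alpha> w u x 0 = x"
  | "svrg_inner F \<alpha> w u x (Suc t) =
       (let y = svrg_inner F \<alpha> w u x t;
            g = sampled_grad F (u t) y - sampled_grad F (u t) w + grad (avg F) w
        in y - \<alpha> *\<^sub>R g)"

text \<open>The state after outer iteration \<open>s\<close> is the pair \<open>(x\<^sub>s\<^sup>m, w\<^sub>s)\<close>; \<open>v s t\<close> is the sampling
  vector drawn at inner step \<open>t < m\<close> of outer iteration \<open>s \<ge> 1\<close>.\<close>

primrec free_svrg ::
    "('n::finite \<Rightarrow> 'a::euclidean_space \<Rightarrow> real) \<Rightarrow> real \<Rightarrow> real \<Rightarrow> nat \<Rightarrow> 'a
       \<Rightarrow> (nat \<Rightarrow> nat \<Rightarrow> real ^ 'n) \<Rightarrow> nat \<Rightarrow> 'a \<times> 'a"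
  where
    "free_svrg F \<alpha> \<mu> m x0 v 0 = (x0, x0)"
  | "free_svrg F \<alpha> \<mu> m x0 v (Suc s) =
       (let (x, w) = free_svrg F \<alpha> \<mu> m x0 v s;
            y = svrg_inner F \<alpha> w (v (Suc s)) x
        in (y m, \<Sum>t<m. weight \<alpha> \<mu> m t *\<^sub>R y t))"

definition lyapunov ::
    "('n::finite \<Rightarrow> 'a::euclidean_space \<Rightarrow> real) \<Rightarrow> real \<Rightarrow> real \<Rightarrow> real \<Rightarrow> nat \<Rightarrow> 'a
       \<Rightarrow> 'a \<times> 'a \<Rightarrow> real" where
  "lyapunov F \<alpha> \<mu> \<rho> m xstar = (\<lambda>(x, w).
     (norm (x - xstar))\<^sup>2
       + 8 * \<alpha>\<^sup>2 * \<rho> * weight_sum \<alpha> \<mu> m * (avg F w - avg F xstar))"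

end

theory Submission
  imports Defs
begin

text \<open>Write \<open>gap x\<close> for \<open>f(x) - f(xstar)\<close> and \<open>q = 1 - \<alpha> \<mu>\<close>. For a fixed inner iterate \<open>y\<close> and reference
  point \<open>w\<close>, the direction \<open>g = \<nabla>f\<^sub>v(y) - \<nabla>f\<^sub>v(w) + \<nabla>f(w)\<close> has mean \<open>\<nabla>f(y)\<close>, and inserting
  \<open>\<nabla>f\<^sub>v(xstar)\<close> splits it into two vectors whose second moments are bounded by \<open>2 LL gap y\<close> and
  \<open>2 \<rho> gap w\<close>. With strong convexity this gives the one-step bound \<open>svrg_step_expected_descent\<close>:
  the expected squared distance to \<open>xstar\<close> is at most
  \<open>q \<parallel>y - xstar\<parallel>\<^sup>2 - 2 \<alpha> (1 - 2 \<alpha> LL) gap y + 4 \<alpha>\<^sup>2 \<rho> gap w\<close>.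

  Each draw is independent of the past, so the bound may be averaged over the random state
  (\<open>expectation_indep_le\<close>, \<open>iterate_expected_descent\<close>). Unrolling over the inner loop weights the gap
  of the \<open>t\<close>-th iterate by \<open>q ^ (m - 1 - t)\<close>. The next reference point is the mean of the iterates
  with these same weights, so by convexity its gap is paid for by the decrease just
  obtained, as soon as \<open>2 \<alpha> (LL + 2 \<rho>) \<le> 1\<close> (\<open>outer_iteration_bounds\<close>, \<open>expected_lyapunov_le\<close>). What is
  left is \<open>q ^ m\<close> times the old squared distance and half of the old reference term.

  For all of this the weights have to be nonnegative, that is \<open>\<alpha> \<mu> \<le> 1\<close>. This follows from the step
  size because \<open>\<mu> \<le> LL\<close> (\<open>mu_le_expected_smoothness\<close>): the second moment of
  \<open>\<nabla>f\<^sub>v(x) - \<nabla>f\<^sub>v(xstar)\<close> is at least \<open>\<parallel>\<nabla>f(x)\<parallel>\<^sup>2\<close>, which strong convexity bounds below by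
  \<open>2 \<mu> gap x\<close>.\<close>

section \<open>Gradients\<close>

lemma GDERIV_difference_quotients:
  fixes g :: "'a::euclidean_space \<Rightarrow> real"
  assumes "GDERIV g x :> G"
  shows "(\<lambda>n. (g (x + (1 / real (Suc n)) *\<^sub>R b) - g x) * real (Suc n)) \<longlonglongrightarrow> inner G b"
proof -
  have "(g has_derivative (\<lambda>h. inner h G)) (at (x + 0 *\<^sub>R b))"
    using assms by (simp add: gderiv_def)
  then have "((\<lambda>r::real. g (x + r *\<^sub>R b)) has_derivative (\<lambda>r. inner (r *\<^sub>R b) G)) (at 0)"
    by (intro has_derivative_compose[of "\<lambda>r. x + r *\<^sub>R b" _ 0 UNIV g])
       (auto intro!: derivative_eq_intros)
  then have "((\<lambda>r::real. g (x + r *\<^sub>R b)) has_real_derivative inner G b) (at 0)"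
    unfolding has_field_derivative_def by (simp add: inner_commute mult_commute_abs)
  then have "((\<lambda>r::real. (g (x + r *\<^sub>R b) - g x) / r) \<longlongrightarrow> inner G b) (at 0)"
    by (simp add: DERIV_def)
  moreover have "filterlim (\<lambda>n. 1 / real (Suc n)) (at 0) sequentially"
    using LIMSEQ_inverse_real_of_nat by (simp add: filterlim_at inverse_eq_divide)
  ultimately have
    "(\<lambda>n. (g (x + (1 / real (Suc n)) *\<^sub>R b) - g x) / (1 / real (Suc n))) \<longlonglongrightarrow> inner G b"
    by (rule filterlim_compose)
  then show ?thesis by simp
qed

text \<open>Each component of a gradient is a pointwise limit of continuous difference quotients, so it
  is Borel measurable even when it is not continuous.\<close>

lemma borel_measurable_grad:
  fixes g :: "'a::euclidean_space \<Rightarrow> real"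
  assumes "\<And>x. g differentiable (at x)"
  shows "grad g \<in> borel_measurable borel"
proof (subst borel_measurable_euclidean_space, intro ballI)
  fix b :: 'a
  have cont: "continuous_on UNIV g"
    using assms
    by (intro differentiable_imp_continuous_on) (simp add: differentiable_on_def)
  then have [measurable]: "g \<in> borel_measurable borel"
    by (rule borel_measurable_continuous_onI)
  show "(\<lambda>x. inner (grad g x) b) \<in> borel_measurable borel"
    by (rule borel_measurable_LIMSEQ_metric[OF _ GDERIV_difference_quotients[OF GDERIV_grad[OF assms]]])
       measurable
qed

lemma grad_eqI:
  fixes g :: "'a::euclidean_space \<Rightarrow> real"
  assumes "GDERIV g x :> G"
  shows "grad g x = G"
proof (rule euclidean_eqI)
  fix b :: 'a
  have "g differentiable (at x)"
    using assms unfolding gderiv_def by (rule differentiableI)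
  then have "GDERIV g x :> grad g x" by (rule GDERIV_grad)
  then show "inner (grad g x) b = inner G b"
    by (intro LIMSEQ_unique[OF GDERIV_difference_quotients GDERIV_difference_quotients[OF assms]])
qed

lemma GDERIV_avg:
  fixes F :: "'n::finite \<Rightarrow> 'a::euclidean_space \<Rightarrow> real"
  assumes "\<And>i. F i differentiable (at x)"
  shows "GDERIV (avg F) x :> (1 / real CARD('n)) *\<^sub>R (\<Sum>i\<in>UNIV. grad (F i) x)"
  unfolding avg_def[abs_def] gderiv_def inner_scaleR_right inner_sum_right
  by (intro has_derivative_mult_right has_derivative_sum)
     (use GDERIV_grad[OF assms] in \<open>simp add: gderiv_def\<close>)

lemma grad_minimizer_eq_0:
  fixes g :: "'a::euclidean_space \<Rightarrow> real"
  assumes "g differentiable (at z)" and "\<And>x. g z \<le> g x"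
  shows "grad g z = 0"
proof -
  have "(\<lambda>h. inner h (grad g z)) = (\<lambda>h. 0)"
    using GDERIV_grad[OF assms(1)] assms(2)
    by (intro has_derivative_local_min[of g _ z]) (auto simp: gderiv_def)
  then show ?thesis by (metis inner_eq_zero_iff)
qed

text \<open>Strong convexity applied at the weighted mean itself: the linear terms cancel.\<close>

lemma strongly_convex_Jensen:
  fixes g :: "'a::euclidean_space \<Rightarrow> real"
  assumes "strongly_convex \<mu> g" and p: "\<And>i. i \<in> I \<Longrightarrow> 0 \<le> p i" "(\<Sum>i\<in>I. p i) = 1"
  shows "g (\<Sum>i\<in>I. p i *\<^sub>R y i) \<le> (\<Sum>i\<in>I. p i * g (y i))"
proof -
  define z where "z = (\<Sum>i\<in>I. p i *\<^sub>R y i)"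
  have tangent: "g z \<le> g y + inner (grad g z) (z - y)" for y
  proof -
    have "g z \<le> g y + inner (grad g z) (z - y) - \<mu> / 2 * (norm (z - y))\<^sup>2" "0 \<le> \<mu>"
      using assms(1) by (auto simp: strongly_convex_def)
    moreover have "0 \<le> \<mu> / 2 * (norm (z - y))\<^sup>2" using \<open>0 \<le> \<mu>\<close> by simp
    ultimately show ?thesis by linarith
  qed
  have "(\<Sum>i\<in>I. p i *\<^sub>R (z - y i)) = (\<Sum>i\<in>I. p i) *\<^sub>R z - z"
    by (simp add: scaleR_diff_right sum_subtractf scaleR_left.sum z_def)
  then have zero: "(\<Sum>i\<in>I. p i *\<^sub>R (z - y i)) = 0" by (simp add: p)
  have "g z = (\<Sum>i\<in>I. p i) * g z" by (simp add: p)
  also have "\<dots> \<le> (\<Sum>i\<in>I. p i * (g (y i) + inner (grad g z) (z - y i)))"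
    unfolding sum_distrib_right by (intro sum_mono mult_left_mono tangent p)
  also have "\<dots> = (\<Sum>i\<in>I. p i * g (y i)) + inner (grad g z) (\<Sum>i\<in>I. p i *\<^sub>R (z - y i))"
    by (simp add: distrib_left sum.distrib inner_sum_right)
  finally have "g z \<le> (\<Sum>i\<in>I. p i * g (y i))" by (simp add: zero)
  then show ?thesis by (simp add: z_def)
qed

lemma norm_diff_sq_le: "(norm (a - b))\<^sup>2 \<le> 2 * (norm a)\<^sup>2 + 2 * (norm b)\<^sup>2"
  for a b :: "'a::real_inner"
proof -
  have "0 \<le> (norm (a + b))\<^sup>2" by simp
  then show ?thesis by (simp add: power2_norm_eq_inner algebra_simps inner_commute)
qed

section \<open>Conditional expectation by independence\<close>

text \<open>Functions \<open>f X\<close> and \<open>g Y\<close> of independent \<open>X\<close> and \<open>Y\<close> have a product law, so a bound on the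
  integral over \<open>g Y\<close> for each fixed value of \<open>f X\<close> may be averaged over \<open>f X\<close> by Tonelli. Since \<open>h\<close>
  is nonnegative, integrability of \<open>h (f X, g Y)\<close> comes out of the same computation.
  The functions \<open>f\<close> and \<open>g\<close> appear in the statement because \<open>indep_var\<close> requires \<open>X\<close> and \<open>Y\<close> to have
  the same type, which \<open>f X\<close> and \<open>g Y\<close> need not have.\<close>

lemma (in prob_space) expectation_indep_le:
  fixes X Y :: "'a \<Rightarrow> 'b" and h :: "'c \<times> 'd \<Rightarrow> real" and k :: "'c \<Rightarrow> real"
  assumes ind: "indep_var S X T Y"
    and f[measurable]: "f \<in> measurable S S'" and g[measurable]: "g \<in> measurable T T'"
    and law: "distr M T' (\<lambda>\<omega>. g (Y \<omega>)) = D"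
    and h[measurable]: "h \<in> borel_measurable (S' \<Otimes>\<^sub>M T')"
    and nonneg: "\<And>z. 0 \<le> h z"
    and int_h: "\<And>x. integrable D (\<lambda>y. h (x, y))"
    and le: "\<And>x. (LINT y|D. h (x, y)) \<le> k x"
    and int_k: "integrable M (\<lambda>\<omega>. k (f (X \<omega>)))"
  shows "integrable M (\<lambda>\<omega>. h (f (X \<omega>), g (Y \<omega>)))"
    and "expectation (\<lambda>\<omega>. h (f (X \<omega>), g (Y \<omega>))) \<le> expectation (\<lambda>\<omega>. k (f (X \<omega>)))"
proof -
  have [measurable]: "X \<in> measurable M S" "Y \<in> measurable M T"
    and XY: "distr M S X \<Otimes>\<^sub>M distr M T Y = distr M (S \<Otimes>\<^sub>M T) (\<lambda>\<omega>. (X \<omega>, Y \<omega>))"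
    using ind by (auto simp: indep_var_distribution_eq)
  have D: "D = distr (distr M T Y) T' g"
    unfolding law[symmetric] by (subst distr_distr) (auto simp: comp_def)
  interpret D: prob_space D unfolding law[symmetric] by (rule prob_space_distr) measurable
  have [measurable_cong]: "sets D = sets T'" by (simp add: D)
  have joint: "distr M S' (\<lambda>\<omega>. f (X \<omega>)) \<Otimes>\<^sub>M D = distr M (S' \<Otimes>\<^sub>M T') (\<lambda>\<omega>. (f (X \<omega>), g (Y \<omega>)))"
  proof -
    have "distr M S' (\<lambda>\<omega>. f (X \<omega>)) = distr (distr M S X) S' f"
      by (subst distr_distr) (auto simp: comp_def)
    then have "distr M S' (\<lambda>\<omega>. f (X \<omega>)) \<Otimes>\<^sub>M D
        = distr (distr M S X \<Otimes>\<^sub>M distr M T Y) (S' \<Otimes>\<^sub>M T') (\<lambda>(x, y). (f x, g y))"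
      using D.sigma_finite_measure_axioms unfolding D by (simp add: pair_measure_distr)
    also have "\<dots> = distr M (S' \<Otimes>\<^sub>M T') (\<lambda>\<omega>. (f (X \<omega>), g (Y \<omega>)))"
      unfolding XY by (subst distr_distr) (auto simp: comp_def)
    finally show ?thesis .
  qed
  have k_nonneg: "0 \<le> k x" for x
    by (rule order_trans[OF Bochner_Integration.integral_nonneg le]) (rule nonneg)
  have "(\<integral>\<^sup>+\<omega>. ennreal (h (f (X \<omega>), g (Y \<omega>))) \<partial>M)
      = (\<integral>\<^sup>+z. ennreal (h z) \<partial>(distr M S' (\<lambda>\<omega>. f (X \<omega>)) \<Otimes>\<^sub>M D))"
    unfolding joint by (subst nn_integral_distr) auto
  also have "\<dots> = (\<integral>\<^sup>+x. \<integral>\<^sup>+y. ennreal (h (x, y)) \<partial>D \<partial>distr M S' (\<lambda>\<omega>. f (X \<omega>)))"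
    by (rule D.nn_integral_fst[symmetric]) measurable
  also have "\<dots> = (\<integral>\<^sup>+\<omega>. \<integral>\<^sup>+y. ennreal (h (f (X \<omega>), y)) \<partial>D \<partial>M)"
    by (subst nn_integral_distr) measurable
  also have "\<dots> \<le> (\<integral>\<^sup>+\<omega>. ennreal (k (f (X \<omega>))) \<partial>M)"
    by (intro nn_integral_mono) (simp add: nn_integral_eq_integral int_h nonneg le ennreal_leI)
  also have "\<dots> = ennreal (expectation (\<lambda>\<omega>. k (f (X \<omega>))))"
    by (intro nn_integral_eq_integral int_k AE_I2 k_nonneg)
  finally have bound: "(\<integral>\<^sup>+\<omega>. ennreal (h (f (X \<omega>), g (Y \<omega>))) \<partial>M)
      \<le> ennreal (expectation (\<lambda>\<omega>. k (f (X \<omega>))))" .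
  have "(\<lambda>\<omega>. h (f (X \<omega>), g (Y \<omega>))) \<in> borel_measurable M" by measurable
  then show int: "integrable M (\<lambda>\<omega>. h (f (X \<omega>), g (Y \<omega>)))"
    using bound by (intro integrableI_nonneg) (auto simp: nonneg intro: le_less_trans)
  have "0 \<le> expectation (\<lambda>\<omega>. k (f (X \<omega>)))" by (simp add: k_nonneg)
  then show "expectation (\<lambda>\<omega>. h (f (X \<omega>), g (Y \<omega>))) \<le> expectation (\<lambda>\<omega>. k (f (X \<omega>)))"
    using bound int by (simp add: nn_integral_eq_integral nonneg)
qed

section \<open>One gradient step in expectation\<close>

locale svrg_objective =
  fixes F :: "'n::finite \<Rightarrow> 'a::euclidean_space \<Rightarrow> real"
    and xstar :: 'a and L \<mu> \<alpha> LL \<rho> :: real and D :: "(real ^ 'n) measure"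
  assumes minimizer: "avg F xstar \<le> avg F x"
    and f_smooth: "L_smooth L (avg F)"
    and f_strongly_convex: "strongly_convex \<mu> (avg F)"
    and differentiable: "F i differentiable (at x)"
    and sampling: "sampling_distribution D"
    and smoothness: "expected_smoothness F D xstar LL"
    and residual: "expected_residual F D xstar \<rho>"
    and step_pos: "0 < \<alpha>"
    and step_bound: "0 < LL + 2 * \<rho> \<Longrightarrow> \<alpha> \<le> 1 / (2 * (LL + 2 * \<rho>))"
begin

abbreviation gap :: "'a \<Rightarrow> real" where
  "gap x \<equiv> avg F x - avg F xstar"

lemma parameters_nonneg: "0 \<le> L" "0 \<le> \<mu>" "0 \<le> LL" "0 \<le> \<rho>"
  using f_smooth f_strongly_convex smoothness residual
  unfolding L_smooth_def strongly_convex_def expected_smoothness_def expected_residual_def by blast+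

lemma gap_nonneg: "0 \<le> gap x"
  using minimizer by simp

text \<open>In this form the step size condition makes sense also when \<open>LL + 2 \<rho> = 0\<close>.\<close>

lemma step_product_le: "2 * \<alpha> * (LL + 2 * \<rho>) \<le> 1"
proof (cases "0 < LL + 2 * \<rho>")
  case True
  then have "\<alpha> * (2 * (LL + 2 * \<rho>)) \<le> 1"
    using step_bound[OF True] by (subst (asm) pos_le_divide_eq) auto
  then show ?thesis by (simp only: ac_simps)
next
  case False
  then have "LL + 2 * \<rho> = 0" using parameters_nonneg by linarith
  then show ?thesis by simp
qed

lemma grad_avg: "grad (avg F) x = (1 / real CARD('n)) *\<^sub>R (\<Sum>i\<in>UNIV. grad (F i) x)"
  by (rule grad_eqI[OF GDERIV_avg[OF differentiable]])

lemma avg_differentiable: "avg F differentiable (at x)"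
  using GDERIV_avg[OF differentiable] unfolding gderiv_def by (rule differentiableI)

lemma grad_avg_xstar: "grad (avg F) xstar = 0"
  by (intro grad_minimizer_eq_0 avg_differentiable minimizer)

lemma gap_le: "gap x \<le> L / 2 * (norm (x - xstar))\<^sup>2"
proof -
  have "avg F x \<le> avg F xstar + inner (grad (avg F) xstar) (x - xstar) + L / 2 * (norm (x - xstar))\<^sup>2"
    using f_smooth by (auto simp: L_smooth_def)
  then show ?thesis by (simp add: grad_avg_xstar)
qed

lemma borel_measurable_avg [measurable]: "avg F \<in> borel_measurable borel"
  by (intro borel_measurable_continuous_onI differentiable_imp_continuous_on)
     (simp add: differentiable_on_def avg_differentiable)

lemma borel_measurable_grad_avg [measurable]: "grad (avg F) \<in> borel_measurable borel"
  by (intro borel_measurable_grad avg_differentiable)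

lemma borel_measurable_grad_component [measurable]: "grad (F i) \<in> borel_measurable borel"
  by (intro borel_measurable_grad differentiable)

lemma borel_measurable_sampled_grad [measurable (raw)]:
  assumes [measurable]: "v \<in> borel_measurable N" "y \<in> borel_measurable N"
  shows "(\<lambda>\<omega>. sampled_grad F (v \<omega>) (y \<omega>)) \<in> borel_measurable N"
proof -
  have [measurable]: "(\<lambda>u. u $ i) \<in> borel_measurable borel" for i :: 'n
    by (intro borel_measurable_continuous_onI continuous_intros)
  show ?thesis unfolding sampled_grad_def by measurable
qed

lemma D_prob: "prob_space D" and sets_D [measurable_cong]: "sets D = sets borel"
  using sampling unfolding sampling_distribution_def by blast+

lemma sampled_grad_unbiased:
  "integrable D (\<lambda>v. sampled_grad F v x)" "(LINT v|D. sampled_grad F v x) = grad (avg F) x"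
proof -
  have v: "integrable D (\<lambda>v. v $ i)" "(LINT v|D. v $ i) = 1" for i
    using sampling unfolding sampling_distribution_def by blast+
  show "integrable D (\<lambda>v. sampled_grad F v x)" unfolding sampled_grad_def
    by (intro integrable_scaleR_right Bochner_Integration.integrable_sum integrable_scaleR_left v)
  show "(LINT v|D. sampled_grad F v x) = grad (avg F) x"
    unfolding sampled_grad_def grad_avg
    by (simp add: Bochner_Integration.integral_sum v)
qed

text \<open>The second moment of \<open>\<nabla>f\<^sub>v(x) - \<nabla>f\<^sub>v(xstar)\<close> dominates the squared norm of the mean of this
  vector, and the mean is \<open>\<nabla>f(x)\<close> because \<open>\<nabla>f(xstar) = 0\<close>.\<close>

lemma norm_grad_sq_le: "(norm (grad (avg F) x))\<^sup>2 \<le> 2 * LL * gap x"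
proof -
  interpret D: prob_space D by (rule D_prob)
  define G where "G = grad (avg F) x"
  let ?h = "\<lambda>v. sampled_grad F v x - sampled_grad F v xstar"
  have int: "integrable D (\<lambda>v. (norm (?h v))\<^sup>2)" "(LINT v|D. (norm (?h v))\<^sup>2) \<le> 2 * LL * gap x"
    using smoothness by (auto simp: expected_smoothness_def)
  have mean: "integrable D ?h" "(LINT v|D. ?h v) = G"
    by (simp_all add: sampled_grad_unbiased grad_avg_xstar G_def)
  have "(LINT v|D. 2 * inner (?h v) G - (norm G)\<^sup>2) \<le> (LINT v|D. (norm (?h v))\<^sup>2)"
  proof (rule integral_mono)
    fix v
    have "0 \<le> (norm (?h v - G))\<^sup>2" by simp
    then show "2 * inner (?h v) G - (norm G)\<^sup>2 \<le> (norm (?h v))\<^sup>2"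
      by (simp add: power2_norm_eq_inner algebra_simps inner_commute)
  qed (use int mean in auto)
  also have "(LINT v|D. 2 * inner (?h v) G - (norm G)\<^sup>2) = (norm G)\<^sup>2"
    using mean by (simp add: D.prob_space power2_norm_eq_inner del: inner_diff_left)
  finally show ?thesis using int by (simp add: G_def)
qed

text \<open>Strong convexity between \<open>x\<close> and the minimizer gives \<open>2 \<mu> gap x \<le> \<parallel>\<nabla>f(x)\<parallel>\<^sup>2\<close>, while expected
  smoothness gives \<open>\<parallel>\<nabla>f(x)\<parallel>\<^sup>2 \<le> 2 LL gap x\<close>. Comparing them at any point other than the minimizer,
  where the gap is positive if \<open>\<mu>\<close> is, forces \<open>\<mu> \<le> LL\<close>.\<close>

lemma mu_le_expected_smoothness: "\<mu> \<le> LL"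
proof (cases "\<mu> = 0")
  case True
  then show ?thesis using parameters_nonneg by simp
next
  case False
  then have mu: "0 < \<mu>" using parameters_nonneg by simp
  obtain b :: 'a where b: "b \<in> Basis" using nonempty_Basis by blast
  define x where "x = xstar + b"
  let ?G = "grad (avg F) x" and ?d = "x - xstar"
  have "avg F xstar \<le> avg F x + inner (grad (avg F) xstar) (xstar - x) - \<mu> / 2 * (norm (xstar - x))\<^sup>2"
    using f_strongly_convex by (auto simp: strongly_convex_def)
  then have "\<mu> / 2 \<le> gap x" using b by (simp add: grad_avg_xstar x_def)
  then have pos: "0 < gap x" using mu by linarith
  have "gap x \<le> inner ?G ?d - \<mu> / 2 * (norm ?d)\<^sup>2"
    using f_strongly_convex unfolding strongly_convex_def by (smt (verit))
  then have "2 * \<mu> * gap x \<le> 2 * \<mu> * (inner ?G ?d - \<mu> / 2 * (norm ?d)\<^sup>2)"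
    using mu by (intro mult_left_mono) auto
  also have "\<dots> \<le> (norm ?G)\<^sup>2"
  proof -
    \<comment> \<open>for fixed gradient, the left-hand side is largest at \<open>?d = ?G / \<mu>\<close>\<close>
    have "0 \<le> (norm (?G - \<mu> *\<^sub>R ?d))\<^sup>2" by simp
    also have "\<dots> = (norm ?G)\<^sup>2 - 2 * \<mu> * inner ?G ?d + \<mu>\<^sup>2 * (norm ?d)\<^sup>2"
      unfolding power2_norm_eq_inner inner_diff_left[of ?G] inner_diff_right[of _ ?G]
      by (simp add: inner_commute power2_eq_square)
    finally show ?thesis by (simp add: algebra_simps power2_eq_square)
  qed
  also have "\<dots> \<le> 2 * LL * gap x" by (rule norm_grad_sq_le)
  finally show ?thesis using pos by simp
qed

lemma contraction_factor_bounds: "1 / 2 \<le> 1 - \<alpha> * \<mu>" "1 - \<alpha> * \<mu> \<le> 1"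
proof -
  have "\<alpha> * \<mu> \<le> \<alpha> * (LL + 2 * \<rho>)"
    using mu_le_expected_smoothness parameters_nonneg step_pos by (intro mult_left_mono) auto
  then show "1 / 2 \<le> 1 - \<alpha> * \<mu>" using step_product_le by linarith
  show "1 - \<alpha> * \<mu> \<le> 1" using step_pos parameters_nonneg by simp
qed

definition svrg_step :: "'a \<Rightarrow> 'a \<Rightarrow> real ^ 'n \<Rightarrow> 'a" where
  "svrg_step w y v = y - \<alpha> *\<^sub>R (sampled_grad F v y - sampled_grad F v w + grad (avg F) w)"

text \<open>The direction \<open>g\<close> has mean \<open>\<nabla>f(y)\<close>, which strong convexity turns into decrease. Its second
  moment is controlled by writing \<open>g = h - r\<close>, where \<open>h\<close> and \<open>r\<close> are exactly the vectors measured by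
  the expected smoothness constant at \<open>y\<close> and by the expected residual constant at \<open>w\<close>.\<close>

lemma svrg_step_expected_descent:
  "integrable D (\<lambda>v. (norm (svrg_step w y v - xstar))\<^sup>2)"
  "(LINT v|D. (norm (svrg_step w y v - xstar))\<^sup>2)
     \<le> (1 - \<alpha> * \<mu>) * (norm (y - xstar))\<^sup>2 - 2 * \<alpha> * (1 - 2 * \<alpha> * LL) * gap y
        + 4 * \<alpha>\<^sup>2 * \<rho> * gap w"
proof -
  interpret D: prob_space D by (rule D_prob)
  define a where "a = y - xstar"
  define h where "h v = sampled_grad F v y - sampled_grad F v xstar" for v
  define r where "r v = sampled_grad F v w - sampled_grad F v xstar - grad (avg F) w" for v
  have h: "integrable D (\<lambda>v. (norm (h v))\<^sup>2)" "(LINT v|D. (norm (h v))\<^sup>2) \<le> 2 * LL * gap y"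
    using smoothness by (auto simp: expected_smoothness_def h_def)
  have r: "integrable D (\<lambda>v. (norm (r v))\<^sup>2)" "(LINT v|D. (norm (r v))\<^sup>2) \<le> 2 * \<rho> * gap w"
    using residual by (auto simp: expected_residual_def r_def)
  have mean: "integrable D h" "(LINT v|D. h v) = grad (avg F) y" "integrable D r" "(LINT v|D. r v) = 0"
    by (simp_all add: h_def[abs_def] r_def[abs_def] sampled_grad_unbiased grad_avg_xstar D.prob_space)
  define B where
    "B v = (norm a)\<^sup>2 - 2 * \<alpha> * inner a (h v - r v) + \<alpha>\<^sup>2 * (2 * (norm (h v))\<^sup>2 + 2 * (norm (r v))\<^sup>2)"
    for v
  have B: "integrable D B" unfolding B_def[abs_def]
    using h r mean by (intro Bochner_Integration.integrable_add Bochner_Integration.integrable_diff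
      integrable_mult_right integrable_inner_right) auto
  have le: "(norm (svrg_step w y v - xstar))\<^sup>2 \<le> B v" for v
  proof -
    have "svrg_step w y v - xstar = a - \<alpha> *\<^sub>R (h v - r v)"
      by (simp add: svrg_step_def a_def h_def r_def)
    then have "(norm (svrg_step w y v - xstar))\<^sup>2
        = (norm a)\<^sup>2 - 2 * \<alpha> * inner a (h v - r v) + \<alpha>\<^sup>2 * (norm (h v - r v))\<^sup>2"
      unfolding power2_norm_eq_inner
      by (simp only: inner_diff_left[of a] inner_diff_right[of _ a])
        (simp add: inner_commute power2_eq_square)
    also have "\<dots> \<le> B v"
      unfolding B_def by (intro add_left_mono mult_left_mono norm_diff_sq_le) simp
    finally show ?thesis .
  qed
  have [measurable]: "(\<lambda>v. (norm (svrg_step w y v - xstar))\<^sup>2) \<in> borel_measurable D"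
    unfolding svrg_step_def by measurable
  show int: "integrable D (\<lambda>v. (norm (svrg_step w y v - xstar))\<^sup>2)"
    by (rule Bochner_Integration.integrable_bound[OF B])
       (auto intro!: AE_I2 order_trans[OF le abs_ge_self])
  have "(LINT v|D. (norm (svrg_step w y v - xstar))\<^sup>2) \<le> (LINT v|D. B v)"
    by (intro integral_mono int B le)
  also have "\<dots> = (norm a)\<^sup>2 - 2 * \<alpha> * inner a (grad (avg F) y)
      + \<alpha>\<^sup>2 * (2 * (LINT v|D. (norm (h v))\<^sup>2) + 2 * (LINT v|D. (norm (r v))\<^sup>2))"
    unfolding B_def using h r mean by (simp add: D.prob_space inner_diff_right)
  also have "\<dots> \<le> (norm a)\<^sup>2 - 2 * \<alpha> * (gap y + \<mu> / 2 * (norm a)\<^sup>2)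
      + \<alpha>\<^sup>2 * (2 * (2 * LL * gap y) + 2 * (2 * \<rho> * gap w))"
  proof (intro add_mono diff_left_mono mult_left_mono)
    have "avg F y \<le> avg F xstar + inner (grad (avg F) y) (y - xstar) - \<mu> / 2 * (norm (y - xstar))\<^sup>2"
      using f_strongly_convex by (auto simp: strongly_convex_def)
    then show "gap y + \<mu> / 2 * (norm a)\<^sup>2 \<le> inner a (grad (avg F) y)"
      by (simp add: a_def inner_commute)
  qed (use h r step_pos in auto)
  also have "\<dots> = (1 - \<alpha> * \<mu>) * (norm a)\<^sup>2 - 2 * \<alpha> * (1 - 2 * \<alpha> * LL) * gap y
        + 4 * \<alpha>\<^sup>2 * \<rho> * gap w"
    by (simp add: algebra_simps power2_eq_square)
  finally show "(LINT v|D. (norm (svrg_step w y v - xstar))\<^sup>2)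
     \<le> (1 - \<alpha> * \<mu>) * (norm (y - xstar))\<^sup>2 - 2 * \<alpha> * (1 - 2 * \<alpha> * LL) * gap y
        + 4 * \<alpha>\<^sup>2 * \<rho> * gap w"
    by (simp add: a_def)
qed

lemma weight_sum_pos:
  assumes "1 \<le> m"
  shows "0 < weight_sum \<alpha> \<mu> m"
proof -
  have "0 < (1 - \<alpha> * \<mu>) ^ k" for k
    using contraction_factor_bounds by (intro zero_less_power) linarith
  then show ?thesis
    unfolding weight_sum_def using assms by (intro sum_pos) (auto simp: lessThan_empty_iff)
qed

lemma weight_nonneg: "1 \<le> m \<Longrightarrow> 0 \<le> weight \<alpha> \<mu> m t"
  unfolding weight_def using contraction_factor_bounds weight_sum_pos[of m]
  by (intro divide_nonneg_pos zero_le_power) auto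

lemma sum_weight: "1 \<le> m \<Longrightarrow> (\<Sum>t<m. weight \<alpha> \<mu> m t) = 1"
  unfolding weight_def sum_divide_distrib[symmetric] using weight_sum_pos[of m]
  by (simp add: weight_sum_def)

section \<open>Iterates as functions of the draws\<close>

text \<open>The inner iterate after \<open>t\<close> steps of outer iteration \<open>s + 1\<close>, paired with the reference point
  of that iteration: with the reference point included, the next state depends only on the current
  state and one new draw.\<close>

definition svrg_state :: "nat \<Rightarrow> 'a \<Rightarrow> (nat \<Rightarrow> nat \<Rightarrow> real ^ 'n) \<Rightarrow> nat \<Rightarrow> nat \<Rightarrow> 'a \<times> 'a" where
  "svrg_state m x0 v s t =
     (let (x, w) = free_svrg F \<alpha> \<mu> m x0 v s in (svrg_inner F \<alpha> w (v (Suc s)) x t, w))"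

lemma svrg_state_0: "svrg_state m x0 v s 0 = free_svrg F \<alpha> \<mu> m x0 v s"
  by (simp add: svrg_state_def split: prod.split)

lemma svrg_state_Suc:
  "svrg_state m x0 v s (Suc t) =
     (svrg_step (snd (svrg_state m x0 v s t)) (fst (svrg_state m x0 v s t)) (v (Suc s) t),
      snd (svrg_state m x0 v s t))"
  by (simp add: svrg_state_def svrg_step_def Let_def split: prod.split)

lemma snd_svrg_state: "snd (svrg_state m x0 v s t) = snd (free_svrg F \<alpha> \<mu> m x0 v s)"
  by (simp add: svrg_state_def split: prod.split)

lemma free_svrg_Suc:
  "free_svrg F \<alpha> \<mu> m x0 v (Suc s) =
     (fst (svrg_state m x0 v s m), \<Sum>t<m. weight \<alpha> \<mu> m t *\<^sub>R fst (svrg_state m x0 v s t))"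
  by (simp add: svrg_state_def Let_def split: prod.split)

definition past_draws :: "nat \<Rightarrow> nat \<Rightarrow> nat \<Rightarrow> (nat \<times> nat) set" where
  "past_draws m s t = {1..s} \<times> {..<m} \<union> {Suc s} \<times> {..<t}"

text \<open>This lemma and \<open>measurable_svrg_state\<close> make the state a measurable function of the draws in
  \<open>past_draws\<close>. The draw used in the next step is not among them, hence independent of the state.\<close>

lemma svrg_state_cong:
  assumes "\<And>r u. (r, u) \<in> past_draws m s t \<Longrightarrow> v r u = v' r u"
  shows "svrg_state m x0 v s t = svrg_state m x0 v' s t"
  using assms
proof (induction s arbitrary: t)
  case 0
  then show ?case
    by (induction t) (auto simp: svrg_state_0 svrg_state_Suc past_draws_def)
next
  case (Suc s)
  have prev: "svrg_state m x0 v s t = svrg_state m x0 v' s t" if "t \<le> m" for t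
    using that by (intro Suc.IH Suc.prems) (auto simp: past_draws_def)
  have "svrg_state m x0 v (Suc s) 0 = svrg_state m x0 v' (Suc s) 0"
    unfolding svrg_state_0 free_svrg_Suc by (auto simp: prev intro!: sum.cong)
  with Suc.prems show ?case
  proof (induction t)
    case 0
    then show ?case by simp
  next
    case (Suc t)
    have "svrg_state m x0 v (Suc s) t = svrg_state m x0 v' (Suc s) t"
      by (intro Suc.IH Suc.prems) (auto simp: past_draws_def)
    moreover have "v (Suc (Suc s)) t = v' (Suc (Suc s)) t"
      by (intro Suc.prems) (simp add: past_draws_def)
    ultimately show ?case by (simp add: svrg_state_Suc)
  qed
qed

lemma borel_measurable_svrg_step [measurable (raw)]:
  assumes [measurable]: "w \<in> borel_measurable N" "y \<in> borel_measurable N" "v \<in> borel_measurable N"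
  shows "(\<lambda>\<omega>. svrg_step (w \<omega>) (y \<omega>) (v \<omega>)) \<in> borel_measurable N"
  unfolding svrg_step_def by measurable

lemma measurable_svrg_state:
  assumes "\<And>r u. (r, u) \<in> past_draws m s t \<Longrightarrow> v r u \<in> borel_measurable N"
  shows "(\<lambda>\<omega>. svrg_state m x0 (\<lambda>r u. v r u \<omega>) s t) \<in> measurable N (borel \<Otimes>\<^sub>M borel)"
  using assms
proof (induction s arbitrary: t)
  have inner: "(\<lambda>\<omega>. svrg_state m x0 (\<lambda>r u. v r u \<omega>) s t) \<in> measurable N (borel \<Otimes>\<^sub>M borel)"
    if "(\<lambda>\<omega>. svrg_state m x0 (\<lambda>r u. v r u \<omega>) s 0) \<in> measurable N (borel \<Otimes>\<^sub>M borel)"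
      and "\<And>r u. (r, u) \<in> past_draws m s t \<Longrightarrow> v r u \<in> borel_measurable N" for s t
    using that
  proof (induction t)
    case 0
    then show ?case by simp
  next
    case (Suc t)
    have [measurable]: "(\<lambda>\<omega>. svrg_state m x0 (\<lambda>r u. v r u \<omega>) s t) \<in> measurable N (borel \<Otimes>\<^sub>M borel)"
      by (intro Suc.IH Suc.prems) (auto simp: past_draws_def)
    have [measurable]: "v (Suc s) t \<in> borel_measurable N"
      by (intro Suc.prems) (auto simp: past_draws_def)
    show ?case unfolding svrg_state_Suc by measurable
  qed
  {
    case 0
    then show ?case by (rule inner[rotated]) (auto simp: svrg_state_0)
  next
    case (Suc s)
    have prev: "(\<lambda>\<omega>. svrg_state m x0 (\<lambda>r u. v r u \<omega>) s t) \<in> measurable N (borel \<Otimes>\<^sub>M borel)"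
      if "t \<le> m" for t
      using that by (intro Suc.IH Suc.prems) (auto simp: past_draws_def)
    have [measurable]: "(\<lambda>\<omega>. fst (svrg_state m x0 (\<lambda>r u. v r u \<omega>) s t)) \<in> borel_measurable N"
      if "t \<le> m" for t
      using prev[OF that] by (rule measurable_compose[OF _ measurable_fst])
    have "(\<lambda>\<omega>. svrg_state m x0 (\<lambda>r u. v r u \<omega>) (Suc s) 0) \<in> measurable N (borel \<Otimes>\<^sub>M borel)"
      unfolding svrg_state_0 free_svrg_Suc by (intro measurable_Pair borel_measurable_sum) measurable
    then show ?case by (rule inner[OF _ Suc.prems])
  }
qed

end

section \<open>Taking expectations along a run\<close>

lemma linear_recursion_le:
  fixes e \<delta> :: "nat \<Rightarrow> real"
  assumes "\<And>t. t < m \<Longrightarrow> e (Suc t) \<le> q * e t - b * \<delta> t + c" and "0 \<le> q"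
  shows "e m \<le> q ^ m * e 0 - b * (\<Sum>t<m. q ^ (m - 1 - t) * \<delta> t) + c * (\<Sum>t<m. q ^ (m - 1 - t))"
  using assms(1)
proof (induction m)
  case 0
  then show ?case by simp
next
  case (Suc m)
  have shift: "(\<Sum>t<Suc m. q ^ (Suc m - 1 - t) * d t) = q * (\<Sum>t<m. q ^ (m - 1 - t) * d t) + d m"
    for d :: "nat \<Rightarrow> real"
  proof -
    have "q ^ (m - t) = q * q ^ (m - 1 - t)" if "t < m" for t
      using that by (metis Suc_diff_Suc diff_Suc_eq_diff_pred power_Suc)
    then show ?thesis by (simp add: sum_distrib_left mult.assoc)
  qed
  have "e (Suc m) \<le> q * e m - b * \<delta> m + c" using Suc.prems by simp
  also have "\<dots> \<le> q * (q ^ m * e 0 - b * (\<Sum>t<m. q ^ (m - 1 - t) * \<delta> t)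
      + c * (\<Sum>t<m. q ^ (m - 1 - t))) - b * \<delta> m + c"
    using Suc assms(2) by (intro add_right_mono diff_right_mono mult_left_mono) auto
  also have "\<dots> = q ^ Suc m * e 0 - b * (q * (\<Sum>t<m. q ^ (m - 1 - t) * \<delta> t) + \<delta> m)
      + c * (q * (\<Sum>t<m. q ^ (m - 1 - t)) + 1)"
    by (simp add: algebra_simps)
  also have "\<dots> = q ^ Suc m * e 0 - b * (\<Sum>t<Suc m. q ^ (Suc m - 1 - t) * \<delta> t)
      + c * (\<Sum>t<Suc m. q ^ (Suc m - 1 - t))"
    using shift[of \<delta>] shift[of "\<lambda>_. 1"] by simp
  finally show ?case .
qed

locale svrg_run = svrg_objective F xstar L \<mu> \<alpha> LL \<rho> D + prob_space M
  for F :: "'n::finite \<Rightarrow> 'a::euclidean_space \<Rightarrow> real"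
    and xstar :: 'a and L \<mu> \<alpha> LL \<rho> :: real and D :: "(real ^ 'n) measure" and M :: "'w measure" +
  fixes m :: nat and x0 :: 'a and V :: "nat \<Rightarrow> nat \<Rightarrow> 'w \<Rightarrow> real ^ 'n"
  assumes inner_length: "1 \<le> m"
    and draws_independent: "indep_vars (\<lambda>_. borel) (\<lambda>(s, t). V s t) ({1..} \<times> {..<m})"
    and draws_distribution: "1 \<le> s \<Longrightarrow> t < m \<Longrightarrow> distr M borel (V s t) = D"
begin

abbreviation iterate :: "nat \<Rightarrow> nat \<Rightarrow> 'w \<Rightarrow> 'a" where
  "iterate s t \<omega> \<equiv> fst (svrg_state m x0 (\<lambda>r u. V r u \<omega>) s t)"

abbreviation reference :: "nat \<Rightarrow> 'w \<Rightarrow> 'a" where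
  "reference s \<omega> \<equiv> snd (free_svrg F \<alpha> \<mu> m x0 (\<lambda>r u. V r u \<omega>) s)"

lemma measurable_state:
  assumes "t \<le> m"
  shows "(\<lambda>\<omega>. svrg_state m x0 (\<lambda>r u. V r u \<omega>) s t) \<in> measurable M (borel \<Otimes>\<^sub>M borel)"
proof (rule measurable_svrg_state)
  fix r u assume "(r, u) \<in> past_draws m s t"
  then have "(r, u) \<in> {1..} \<times> {..<m}" using assms by (auto simp: past_draws_def)
  then have "(case (r, u) of (s, t) \<Rightarrow> V s t) \<in> borel_measurable M"
    using draws_independent[unfolded indep_vars_def, THEN conjunct1] by (rule bspec[rotated])
  then show "V r u \<in> borel_measurable M" by simp
qed

lemma measurable_iterate: "t \<le> m \<Longrightarrow> iterate s t \<in> borel_measurable M"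
  by (rule measurable_compose[OF measurable_state measurable_fst])

lemma measurable_reference: "reference s \<in> borel_measurable M"
proof -
  have "(\<lambda>\<omega>. snd (svrg_state m x0 (\<lambda>r u. V r u \<omega>) s 0)) \<in> borel_measurable M"
    by (rule measurable_compose[OF measurable_state measurable_snd]) simp
  then show ?thesis by (simp only: snd_svrg_state)
qed

text \<open>The draw used in an inner step is independent of all earlier draws, hence of the current state;
  so the one-step bound for a fixed state may be averaged over the state.\<close>

lemma iterate_expected_descent:
  assumes t: "t < m"
    and int: "integrable M (\<lambda>\<omega>. (norm (iterate s t \<omega> - xstar))\<^sup>2)"
      "integrable M (\<lambda>\<omega>. gap (iterate s t \<omega>))" "integrable M (\<lambda>\<omega>. gap (reference s \<omega>))"
  shows "integrable M (\<lambda>\<omega>. (norm (iterate s (Suc t) \<omega> - xstar))\<^sup>2)"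
    and "expectation (\<lambda>\<omega>. (norm (iterate s (Suc t) \<omega> - xstar))\<^sup>2)
      \<le> (1 - \<alpha> * \<mu>) * expectation (\<lambda>\<omega>. (norm (iterate s t \<omega> - xstar))\<^sup>2)
        - 2 * \<alpha> * (1 - 2 * \<alpha> * LL) * expectation (\<lambda>\<omega>. gap (iterate s t \<omega>))
        + 4 * \<alpha>\<^sup>2 * \<rho> * expectation (\<lambda>\<omega>. gap (reference s \<omega>))"
proof -
  define A where "A = past_draws m s t"
  define B where "B = {(Suc s, t)}"
  define X where "X \<omega> = restrict (\<lambda>i. (case i of (r, u) \<Rightarrow> V r u) \<omega>) A" for \<omega>
  define Y where "Y \<omega> = restrict (\<lambda>i. (case i of (r, u) \<Rightarrow> V r u) \<omega>) B" for \<omega>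
  define f where "f u = svrg_state m x0 (\<lambda>r k. u (r, k)) s t" for u :: "nat \<times> nat \<Rightarrow> real ^ 'n"
  define g where "g u = u (Suc s, t)" for u :: "nat \<times> nat \<Rightarrow> real ^ 'n"
  define h where "h z = (norm (svrg_step (snd (fst z)) (fst (fst z)) (snd z) - xstar))\<^sup>2"
    for z :: "('a \<times> 'a) \<times> (real ^ 'n)"
  define k where "k z = (1 - \<alpha> * \<mu>) * (norm (fst z - xstar))\<^sup>2
    - 2 * \<alpha> * (1 - 2 * \<alpha> * LL) * gap (fst z) + 4 * \<alpha>\<^sup>2 * \<rho> * gap (snd z)" for z :: "'a \<times> 'a"
  have ind: "indep_var (PiM A (\<lambda>_. borel)) X (PiM B (\<lambda>_. borel)) Y"
    unfolding X_def[abs_def] Y_def[abs_def]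
    using t by (intro indep_var_restrict[OF draws_independent]) (auto simp: A_def B_def past_draws_def)
  have f: "f \<in> measurable (PiM A (\<lambda>_. borel)) (borel \<Otimes>\<^sub>M borel)"
    unfolding f_def[abs_def]
    by (intro measurable_svrg_state measurable_component_singleton) (simp add: A_def)
  have g: "g \<in> measurable (PiM B (\<lambda>_. borel)) borel"
    unfolding g_def[abs_def] by (intro measurable_component_singleton) (simp add: B_def)
  have fX: "f (X \<omega>) = svrg_state m x0 (\<lambda>r u. V r u \<omega>) s t" for \<omega>
    unfolding f_def by (rule svrg_state_cong) (simp add: X_def A_def)
  have gY: "g (Y \<omega>) = V (Suc s) t \<omega>" for \<omega>
    by (simp add: g_def Y_def B_def)
  have law: "distr M borel (\<lambda>\<omega>. g (Y \<omega>)) = D"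
    unfolding gY using draws_distribution[of "Suc s" t] t by simp
  have h: "h \<in> borel_measurable ((borel \<Otimes>\<^sub>M borel) \<Otimes>\<^sub>M borel)"
    unfolding h_def[abs_def] by measurable
  have h_step: "h (f (X \<omega>), g (Y \<omega>)) = (norm (iterate s (Suc t) \<omega> - xstar))\<^sup>2" for \<omega>
    by (simp add: h_def fX gY svrg_state_Suc)
  have k_state: "k (f (X \<omega>)) = (1 - \<alpha> * \<mu>) * (norm (iterate s t \<omega> - xstar))\<^sup>2
    - 2 * \<alpha> * (1 - 2 * \<alpha> * LL) * gap (iterate s t \<omega>) + 4 * \<alpha>\<^sup>2 * \<rho> * gap (reference s \<omega>)" for \<omega>
    by (simp only: k_def fX snd_svrg_state)
  have int_k: "integrable M (\<lambda>\<omega>. k (f (X \<omega>)))"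
    unfolding k_state by (intro Bochner_Integration.integrable_add Bochner_Integration.integrable_diff
      integrable_mult_right int)
  have fixed_state: "integrable D (\<lambda>v. h (z, v))" "(LINT v|D. h (z, v)) \<le> k z" for z
    unfolding h_def k_def fst_conv snd_conv by (rule svrg_step_expected_descent)+
  have nonneg: "0 \<le> h z" for z by (simp add: h_def)
  note avg = expectation_indep_le[where X = X and Y = Y and f = f and g = g and h = h and k = k,
      OF ind f g law h nonneg fixed_state int_k]
  show "integrable M (\<lambda>\<omega>. (norm (iterate s (Suc t) \<omega> - xstar))\<^sup>2)"
    using avg(1) by (simp only: h_step)
  have "expectation (\<lambda>\<omega>. (norm (iterate s (Suc t) \<omega> - xstar))\<^sup>2) \<le> expectation (\<lambda>\<omega>. k (f (X \<omega>)))"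
    using avg(2) by (simp only: h_step)
  also have "\<dots> = (1 - \<alpha> * \<mu>) * expectation (\<lambda>\<omega>. (norm (iterate s t \<omega> - xstar))\<^sup>2)
        - 2 * \<alpha> * (1 - 2 * \<alpha> * LL) * expectation (\<lambda>\<omega>. gap (iterate s t \<omega>))
        + 4 * \<alpha>\<^sup>2 * \<rho> * expectation (\<lambda>\<omega>. gap (reference s \<omega>))"
  proof -
    have linear: "expectation (\<lambda>\<omega>. p * a \<omega> - q * b \<omega> + r * c \<omega>) = p * expectation a - q * expectation b + r * expectation c"
      if "integrable M a" "integrable M b" "integrable M c" for p q r :: real and a b c
      using that by simp
    show ?thesis unfolding k_state by (rule linear[OF int])
  qed
  finally show "expectation (\<lambda>\<omega>. (norm (iterate s (Suc t) \<omega> - xstar))\<^sup>2)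
      \<le> (1 - \<alpha> * \<mu>) * expectation (\<lambda>\<omega>. (norm (iterate s t \<omega> - xstar))\<^sup>2)
        - 2 * \<alpha> * (1 - 2 * \<alpha> * LL) * expectation (\<lambda>\<omega>. gap (iterate s t \<omega>))
        + 4 * \<alpha>\<^sup>2 * \<rho> * expectation (\<lambda>\<omega>. gap (reference s \<omega>))" .
qed

text \<open>Smoothness bounds the gap by the squared distance, so square integrability suffices.\<close>

lemma integrable_gap_iterate:
  assumes "t \<le> m" and "integrable M (\<lambda>\<omega>. (norm (iterate s t \<omega> - xstar))\<^sup>2)"
  shows "integrable M (\<lambda>\<omega>. gap (iterate s t \<omega>))"
proof (rule Bochner_Integration.integrable_bound)
  show "integrable M (\<lambda>\<omega>. L / 2 * (norm (iterate s t \<omega> - xstar))\<^sup>2)"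
    by (intro integrable_mult_right assms)
  have [measurable]: "iterate s t \<in> borel_measurable M"
    by (rule measurable_iterate) fact
  show "(\<lambda>\<omega>. gap (iterate s t \<omega>)) \<in> borel_measurable M"
    by measurable
  show "AE \<omega> in M. norm (gap (iterate s t \<omega>)) \<le> norm (L / 2 * (norm (iterate s t \<omega> - xstar))\<^sup>2)"
    by (intro AE_I2) (simp only: real_norm_def abs_of_nonneg[OF gap_nonneg] order_trans[OF gap_le abs_ge_self])
qed

lemma integrable_iterate:
  assumes "t \<le> m" and "integrable M (\<lambda>\<omega>. (norm (iterate s 0 \<omega> - xstar))\<^sup>2)"
    and "integrable M (\<lambda>\<omega>. gap (reference s \<omega>))"
  shows "integrable M (\<lambda>\<omega>. (norm (iterate s t \<omega> - xstar))\<^sup>2)"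
  using assms(1)
proof (induction t)
  case 0
  then show ?case by (simp add: assms)
next
  case (Suc t)
  then show ?case
    by (intro iterate_expected_descent integrable_gap_iterate assms) auto
qed

text \<open>Unrolling the inner loop produces the weights \<open>(1 - \<alpha> \<mu>) ^ (m - 1 - t)\<close> in front of the gaps of
  the inner iterates. These are the weights that define the next reference point, so by Jensen the
  same weighted sum \<open>\<Delta>\<close> bounds the weight sum times the next reference gap from above.\<close>

lemma outer_iteration_bounds:
  assumes dist: "integrable M (\<lambda>\<omega>. (norm (iterate s 0 \<omega> - xstar))\<^sup>2)"
    and ref: "integrable M (\<lambda>\<omega>. gap (reference s \<omega>))"
  obtains \<Delta> where "0 \<le> \<Delta>"
    and "integrable M (\<lambda>\<omega>. (norm (iterate (Suc s) 0 \<omega> - xstar))\<^sup>2)"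
    and "expectation (\<lambda>\<omega>. (norm (iterate (Suc s) 0 \<omega> - xstar))\<^sup>2)
      \<le> (1 - \<alpha> * \<mu>) ^ m * expectation (\<lambda>\<omega>. (norm (iterate s 0 \<omega> - xstar))\<^sup>2)
        - 2 * \<alpha> * (1 - 2 * \<alpha> * LL) * \<Delta>
        + 4 * \<alpha>\<^sup>2 * \<rho> * weight_sum \<alpha> \<mu> m * expectation (\<lambda>\<omega>. gap (reference s \<omega>))"
    and "integrable M (\<lambda>\<omega>. gap (reference (Suc s) \<omega>))"
    and "weight_sum \<alpha> \<mu> m * expectation (\<lambda>\<omega>. gap (reference (Suc s) \<omega>)) \<le> \<Delta>"
proof -
  define q where "q = 1 - \<alpha> * \<mu>"
  define W where "W = weight_sum \<alpha> \<mu> m"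
  define p where "p = weight \<alpha> \<mu> m"
  define e where "e t = expectation (\<lambda>\<omega>. (norm (iterate s t \<omega> - xstar))\<^sup>2)" for t
  define \<delta> where "\<delta> t = expectation (\<lambda>\<omega>. gap (iterate s t \<omega>))" for t
  define c where "c = 4 * \<alpha>\<^sup>2 * \<rho> * expectation (\<lambda>\<omega>. gap (reference s \<omega>))"
  define \<Delta> where "\<Delta> = (\<Sum>t<m. q ^ (m - 1 - t) * \<delta> t)"
  have W: "0 < W" unfolding W_def using inner_length by (rule weight_sum_pos)
  have p: "0 \<le> p t" "W * p t = q ^ (m - 1 - t)" for t
    using weight_nonneg[OF inner_length] W by (simp_all add: p_def weight_def W_def q_def)
  have q: "0 \<le> q" using contraction_factor_bounds by (simp add: q_def)
  have int_e: "integrable M (\<lambda>\<omega>. (norm (iterate s t \<omega> - xstar))\<^sup>2)" if "t \<le> m" for t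
    by (rule integrable_iterate[OF that dist ref])
  have int_\<delta>: "integrable M (\<lambda>\<omega>. gap (iterate s t \<omega>))" if "t \<le> m" for t
    by (rule integrable_gap_iterate[OF that int_e[OF that]])
  have \<delta>_nonneg: "0 \<le> \<delta> t" for t unfolding \<delta>_def by (intro Bochner_Integration.integral_nonneg gap_nonneg)
  have next_iterate: "iterate (Suc s) 0 \<omega> = iterate s m \<omega>" for \<omega>
    by (simp only: svrg_state_0 free_svrg_Suc fst_conv)
  have "e m \<le> q ^ m * e 0 - 2 * \<alpha> * (1 - 2 * \<alpha> * LL) * (\<Sum>t<m. q ^ (m - 1 - t) * \<delta> t)
      + c * (\<Sum>t<m. q ^ (m - 1 - t))"
    unfolding e_def \<delta>_def c_def q_def
    by (intro linear_recursion_le iterate_expected_descent int_e int_\<delta> ref q[unfolded q_def]) auto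
  then have descent: "e m \<le> q ^ m * e 0 - 2 * \<alpha> * (1 - 2 * \<alpha> * LL) * \<Delta>
      + 4 * \<alpha>\<^sup>2 * \<rho> * W * expectation (\<lambda>\<omega>. gap (reference s \<omega>))"
    by (simp add: \<Delta>_def c_def W_def weight_sum_def q_def mult_ac)
  have ref_le: "gap (reference (Suc s) \<omega>) \<le> (\<Sum>t<m. p t * gap (iterate s t \<omega>))" for \<omega>
  proof -
    have "reference (Suc s) \<omega> = (\<Sum>t<m. p t *\<^sub>R iterate s t \<omega>)"
      by (simp only: free_svrg_Suc snd_conv p_def)
    moreover have "avg F (\<Sum>t<m. p t *\<^sub>R iterate s t \<omega>) \<le> (\<Sum>t<m. p t * avg F (iterate s t \<omega>))"
      by (intro strongly_convex_Jensen[OF f_strongly_convex] p)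
         (simp add: p_def sum_weight[OF inner_length])
    moreover have "(\<Sum>t<m. p t * gap (iterate s t \<omega>))
        = (\<Sum>t<m. p t * avg F (iterate s t \<omega>)) - avg F xstar"
      by (simp add: right_diff_distrib sum_subtractf sum_distrib_right[symmetric] p_def
          sum_weight[OF inner_length])
    ultimately show ?thesis by simp
  qed
  have int_sum: "integrable M (\<lambda>\<omega>. \<Sum>t<m. p t * gap (iterate s t \<omega>))"
    by (intro Bochner_Integration.integrable_sum integrable_mult_right int_\<delta>) simp
  have [measurable]: "reference (Suc s) \<in> borel_measurable M" by (rule measurable_reference)
  have int_ref: "integrable M (\<lambda>\<omega>. gap (reference (Suc s) \<omega>))"
  proof (rule Bochner_Integration.integrable_bound[OF int_sum])
    show "(\<lambda>\<omega>. gap (reference (Suc s) \<omega>)) \<in> borel_measurable M" by measurable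
    show "AE \<omega> in M. norm (gap (reference (Suc s) \<omega>)) \<le> norm (\<Sum>t<m. p t * gap (iterate s t \<omega>))"
      by (intro AE_I2)
        (simp only: real_norm_def abs_of_nonneg[OF gap_nonneg] order_trans[OF ref_le abs_ge_self])
  qed
  have "W * expectation (\<lambda>\<omega>. gap (reference (Suc s) \<omega>))
      \<le> W * expectation (\<lambda>\<omega>. \<Sum>t<m. p t * gap (iterate s t \<omega>))"
    using W by (intro mult_left_mono integral_mono int_ref int_sum ref_le) simp
  also have "expectation (\<lambda>\<omega>. \<Sum>t<m. p t * gap (iterate s t \<omega>)) = (\<Sum>t<m. p t * \<delta> t)"
  proof -
    have "expectation (\<lambda>\<omega>. \<Sum>t<m. p t * gap (iterate s t \<omega>))
        = (\<Sum>t<m. expectation (\<lambda>\<omega>. p t * gap (iterate s t \<omega>)))"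
      by (intro Bochner_Integration.integral_sum integrable_mult_right int_\<delta>) simp
    then show ?thesis by (simp only: \<delta>_def integral_mult_right_zero)
  qed
  also have "W * (\<Sum>t<m. p t * \<delta> t) = \<Delta>"
    by (simp add: sum_distrib_left mult.assoc[symmetric] p \<Delta>_def)
  finally have "W * expectation (\<lambda>\<omega>. gap (reference (Suc s) \<omega>)) \<le> \<Delta>" .
  moreover have "0 \<le> \<Delta>" unfolding \<Delta>_def using q \<delta>_nonneg by (intro sum_nonneg mult_nonneg_nonneg) auto
  ultimately show ?thesis
    by (intro that[of \<Delta>, unfolded next_iterate, folded W_def q_def] descent[unfolded e_def]
      int_e[of m] int_ref order_refl)
qed

lemma expected_lyapunov:
  assumes "integrable M (\<lambda>\<omega>. (norm (iterate s 0 \<omega> - xstar))\<^sup>2)"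
    and "integrable M (\<lambda>\<omega>. gap (reference s \<omega>))"
  shows "integrable M (\<lambda>\<omega>. lyapunov F \<alpha> \<mu> \<rho> m xstar (free_svrg F \<alpha> \<mu> m x0 (\<lambda>r t. V r t \<omega>) s))"
    and "expectation (\<lambda>\<omega>. lyapunov F \<alpha> \<mu> \<rho> m xstar (free_svrg F \<alpha> \<mu> m x0 (\<lambda>r t. V r t \<omega>) s))
      = expectation (\<lambda>\<omega>. (norm (iterate s 0 \<omega> - xstar))\<^sup>2)
        + 8 * \<alpha>\<^sup>2 * \<rho> * weight_sum \<alpha> \<mu> m * expectation (\<lambda>\<omega>. gap (reference s \<omega>))"
proof -
  have eq: "lyapunov F \<alpha> \<mu> \<rho> m xstar (free_svrg F \<alpha> \<mu> m x0 (\<lambda>r t. V r t \<omega>) s)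
      = (norm (iterate s 0 \<omega> - xstar))\<^sup>2 + 8 * \<alpha>\<^sup>2 * \<rho> * weight_sum \<alpha> \<mu> m * gap (reference s \<omega>)" for \<omega>
    by (simp add: lyapunov_def svrg_state_0 split: prod.split)
  show "integrable M (\<lambda>\<omega>. lyapunov F \<alpha> \<mu> \<rho> m xstar (free_svrg F \<alpha> \<mu> m x0 (\<lambda>r t. V r t \<omega>) s))"
    unfolding eq by (intro Bochner_Integration.integrable_add integrable_mult_right assms)
  show "expectation (\<lambda>\<omega>. lyapunov F \<alpha> \<mu> \<rho> m xstar (free_svrg F \<alpha> \<mu> m x0 (\<lambda>r t. V r t \<omega>) s))
      = expectation (\<lambda>\<omega>. (norm (iterate s 0 \<omega> - xstar))\<^sup>2)
        + 8 * \<alpha>\<^sup>2 * \<rho> * weight_sum \<alpha> \<mu> m * expectation (\<lambda>\<omega>. gap (reference s \<omega>))"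
  proof -
    have linear: "expectation (\<lambda>\<omega>. a \<omega> + c * b \<omega>) = expectation a + c * expectation b"
      if "integrable M a" "integrable M b" for c :: real and a b
      using that by simp
    show ?thesis unfolding eq by (rule linear[OF assms])
  qed
qed

text \<open>Adding \<open>8 \<alpha>\<^sup>2 \<rho>\<close> times the bound on the new reference gap to the bound on the new distance, the
  coefficient of \<open>\<Delta>\<close> becomes \<open>- 2 \<alpha> (1 - 2 \<alpha> (LL + 2 \<rho>))\<close>, which the step size makes nonpositive. What
  remains of the old reference gap is half of its term in the Lyapunov function.\<close>

lemma expected_lyapunov_le:
  "integrable M (\<lambda>\<omega>. lyapunov F \<alpha> \<mu> \<rho> m xstar (free_svrg F \<alpha> \<mu> m x0 (\<lambda>r t. V r t \<omega>) s)) \<and>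
   expectation (\<lambda>\<omega>. lyapunov F \<alpha> \<mu> \<rho> m xstar (free_svrg F \<alpha> \<mu> m x0 (\<lambda>r t. V r t \<omega>) s))
     \<le> max ((1 - \<alpha> * \<mu>) ^ m) (1 / 2) ^ s * lyapunov F \<alpha> \<mu> \<rho> m xstar (x0, x0)"
proof -
  define W where "W = weight_sum \<alpha> \<mu> m"
  define \<beta> where "\<beta> = max ((1 - \<alpha> * \<mu>) ^ m) (1 / 2)"
  define A where "A s = expectation (\<lambda>\<omega>. (norm (iterate s 0 \<omega> - xstar))\<^sup>2)" for s
  define B where "B s = expectation (\<lambda>\<omega>. gap (reference s \<omega>))" for s
  have W: "0 < W" unfolding W_def using inner_length by (rule weight_sum_pos)
  have \<beta>: "0 \<le> \<beta>" "(1 - \<alpha> * \<mu>) ^ m \<le> \<beta>" "1 / 2 \<le> \<beta>" unfolding \<beta>_def by auto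
  have A_nonneg: "0 \<le> A s" for s unfolding A_def by simp
  have B_nonneg: "0 \<le> B s" for s unfolding B_def by (intro Bochner_Integration.integral_nonneg gap_nonneg)
  have "integrable M (\<lambda>\<omega>. (norm (iterate s 0 \<omega> - xstar))\<^sup>2) \<and> integrable M (\<lambda>\<omega>. gap (reference s \<omega>)) \<and>
    A s + 8 * \<alpha>\<^sup>2 * \<rho> * W * B s \<le> \<beta> ^ s * lyapunov F \<alpha> \<mu> \<rho> m xstar (x0, x0)" for s
  proof (induction s)
    case 0
    show ?case
      by (simp add: A_def B_def svrg_state_0 lyapunov_def prob_space W_def)
  next
    case (Suc s)
    then have prev: "integrable M (\<lambda>\<omega>. (norm (iterate s 0 \<omega> - xstar))\<^sup>2)"
      "integrable M (\<lambda>\<omega>. gap (reference s \<omega>))"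
      by blast+
    obtain \<Delta> where \<Delta>: "0 \<le> \<Delta>"
      and int: "integrable M (\<lambda>\<omega>. (norm (iterate (Suc s) 0 \<omega> - xstar))\<^sup>2)"
        "integrable M (\<lambda>\<omega>. gap (reference (Suc s) \<omega>))"
      and dist: "A (Suc s) \<le> (1 - \<alpha> * \<mu>) ^ m * A s - 2 * \<alpha> * (1 - 2 * \<alpha> * LL) * \<Delta> + 4 * \<alpha>\<^sup>2 * \<rho> * W * B s"
      and ref: "W * B (Suc s) \<le> \<Delta>"
      unfolding A_def B_def W_def by (rule outer_iteration_bounds[OF prev])
    have "8 * \<alpha>\<^sup>2 * \<rho> * (W * B (Suc s)) \<le> 8 * \<alpha>\<^sup>2 * \<rho> * \<Delta>"
      using parameters_nonneg by (intro mult_left_mono ref) auto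
    then have "A (Suc s) + 8 * \<alpha>\<^sup>2 * \<rho> * W * B (Suc s)
        \<le> (1 - \<alpha> * \<mu>) ^ m * A s + 1 / 2 * (8 * \<alpha>\<^sup>2 * \<rho> * W * B s)
          - 2 * \<alpha> * (1 - 2 * \<alpha> * (LL + 2 * \<rho>)) * \<Delta>"
      using dist by (simp add: algebra_simps power2_eq_square)
    also have "\<dots> \<le> (1 - \<alpha> * \<mu>) ^ m * A s + 1 / 2 * (8 * \<alpha>\<^sup>2 * \<rho> * W * B s)"
      using step_pos step_product_le \<Delta> by simp
    also have "\<dots> \<le> \<beta> * A s + \<beta> * (8 * \<alpha>\<^sup>2 * \<rho> * W * B s)"
      using \<beta> A_nonneg B_nonneg W parameters_nonneg
      by (intro add_mono mult_right_mono) auto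
    also have "\<dots> = \<beta> * (A s + 8 * \<alpha>\<^sup>2 * \<rho> * W * B s)" by (simp add: distrib_left)
    also have "\<dots> \<le> \<beta> * (\<beta> ^ s * lyapunov F \<alpha> \<mu> \<rho> m xstar (x0, x0))"
      using Suc \<beta>(1) by (intro mult_left_mono) blast+
    finally show ?case using int by (simp only: power_Suc mult.assoc simp_thms)
  qed
  then have int: "integrable M (\<lambda>\<omega>. (norm (iterate s 0 \<omega> - xstar))\<^sup>2)"
      "integrable M (\<lambda>\<omega>. gap (reference s \<omega>))"
    and le: "A s + 8 * \<alpha>\<^sup>2 * \<rho> * W * B s \<le> \<beta> ^ s * lyapunov F \<alpha> \<mu> \<rho> m xstar (x0, x0)"
    by blast+
  show ?thesis
    unfolding expected_lyapunov(2)[OF int]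
    using expected_lyapunov(1)[OF int] le[unfolded A_def B_def W_def \<beta>_def] by blast
qed

end

theorem theorem4p1:
  fixes F :: "'n::finite \<Rightarrow> real ^ 'd::finite \<Rightarrow> real"
    and xstar x0 :: "real ^ 'd"
    and L \<mu> \<alpha> LL \<rho> :: real
    and Li :: "'n \<Rightarrow> real"
    and m :: nat
    and D :: "(real ^ 'n) measure"
    and M :: "'w measure"
    and V :: "nat \<Rightarrow> nat \<Rightarrow> 'w \<Rightarrow> real ^ 'n"
  assumes minimizer: "\<forall>x. avg F xstar \<le> avg F x"
    and f_smooth: "L_smooth L (avg F)"
    and f_strongly_convex: "strongly_convex \<mu> (avg F)"
    and fi_differentiable: "\<forall>i x. F i differentiable (at x)"
    and fi_convex: "\<forall>i. convex_on UNIV (F i)"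
    and fi_smooth: "\<forall>i. L_smooth (Li i) (F i)"
    and sampling: "sampling_distribution D"
    and smoothness: "expected_smoothness F D xstar LL"
    and residual: "expected_residual F D xstar \<rho>"
    and inner_length: "m \<ge> 1"
    and step_pos: "\<alpha> > 0"
    \<comment> \<open>the bound is read as infinite, i.e. void, when the denominator vanishes\<close>
    and step_bound: "LL + 2 * \<rho> > 0 \<Longrightarrow> \<alpha> \<le> 1 / (2 * (LL + 2 * \<rho>))"
    and prob: "prob_space M"
    and draws_independent:
      "prob_space.indep_vars M (\<lambda>_. borel) (\<lambda>(s, t). V s t) ({1..} \<times> {..<m})"
    and draws_distribution: "\<forall>s\<ge>1. \<forall>t<m. distr M borel (V s t) = D"
  defines "\<phi> \<equiv> (\<lambda>s \<omega>. lyapunov F \<alpha> \<mu> \<rho> m xstar (free_svrg F \<alpha> \<mu> m x0 (\<lambda>r t. V r t \<omega>) s))"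
    and "\<phi>0 \<equiv> lyapunov F \<alpha> \<mu> \<rho> m xstar (x0, x0)"
    and "\<beta> \<equiv> max ((1 - \<alpha> * \<mu>) ^ m) (1 / 2)"
  shows "\<forall>s. integrable M (\<phi> s) \<and> prob_space.expectation M (\<phi> s) \<le> \<beta> ^ s * \<phi>0"
proof -
  interpret svrg_run F xstar L \<mu> \<alpha> LL \<rho> D M m x0 V
    using assms(1-15) by (intro svrg_run.intro svrg_objective.intro svrg_run_axioms.intro) auto
  show ?thesis
    unfolding \<phi>_def \<phi>0_def \<beta>_def by (intro allI expected_lyapunov_le)
qed

end
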